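(* Let $X$ be a real Banach space, $K$ a nonempty subset of $X$, $A\colon X\to X^*$, $\varphi\colon X\times X\to\mathbb{R}$, $j\colon X\to\mathbb{R}$. Assume that: - $j$ is locally Lipschitz; - $A$ is strongly monotone: there is $m_A>0$ with $\langle Av_1-Av_2,v_1-v_2\rangle\ge m_A\|v_1-v_2\|_X^2$ for all $v_1,v_2\in X$; - there is $\alpha_\varphi>0$ such that for all $\eta_1,\eta_2,v_1,v_2\in X$ $$\varphi(\eta_1,v_2)-\varphi(\eta_1,v_1)+\varphi(\eta_2,v_1)-\varphi(\eta_2,v_2)\le\alpha_\varphi\|\eta_1-\eta_2\|_X\|v_1-v_2\|_X;$$ - there is $\alpha_j>0$ such that $j^0(v_1;v_2-v_1)+j^0(v_2;v_1-v_2)\le\alpha_j\|v_1-v_2\|_X^2$ for all $v_1,v_2\in X$; - these constants satisfy $\alpha_\varphi+\alpha_j<m_A$. Then, for all $f\in X^*$, the following statements are equivalent: (a) The variational-hemivariational inequality: find $u\in K$ such that $$\langle Au,v-u\rangle+\varphi(u,v)-\varphi(u,u)+j^0(u;v-u)\ge\langle f,v-u\rangle\quad\forall\,v\in K\qquad(\mathrm{VHI})$$ has a unique solution. (b) The inequality (VHI) is well-posed.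
   Context: $\langle\cdot,\cdot\rangle$ is the duality pairing between $X^*$ and $X$. For a locally Lipschitz function $j\colon X\to\mathbb{R}$ (each point has a neighborhood on which $j$ is Lipschitz continuous), the generalized (Clarke) directional derivative of $j$ at $u$ in the direction $v$ is $j^0(u;v)=\limsup_{x\to u,\ \lambda\downarrow0}\frac{j(x+\lambda v)-j(x)}{\lambda}$. A sequence $\{u_n\}\subset K$ is an approximating sequence for (VHI) if there exists a sequence $\{\varepsilon_n\}\subset\mathbb{R}$ with $0<\varepsilon_n\to0$ such that for each $n\in\mathbb{N}$ $$\langle Au_n,v-u_n\rangle+\varphi(u_n,v)-\varphi(u_n,u_n)+j^0(u_n;v-u_n)\ge\langle f,v-u_n\rangle-\varepsilon_n\|u_n-v\|_X\quad\forall\,v\in K.$$ (VHI) is well-posed (in the sense of Tykhonov) if it has a unique solution and every approximating sequence for (VHI) converges strongly in $X$ to that solution. *)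

theory Defs
  imports "HOL-Analysis.Analysis"
begin

definition locally_lipschitz :: "('a::real_normed_vector \<Rightarrow> real) \<Rightarrow> bool" where
  "locally_lipschitz j \<longleftrightarrow> (\<forall>x. \<exists>U L. open U \<and> x \<in> U \<and> L-lipschitz_on U j)"

text \<open>
  The limes superior is taken jointly in \<open>x \<rightarrow> u\<close> (with \<open>x = u\<close> allowed) and \<open>\<lambda> \<down> 0\<close>.
  It is formed in the extended reals; the projection to the reals loses nothing
  for locally Lipschitz functions, see \<open>ereal_clarke_deriv\<close> below.
\<close>

definition clarke_deriv :: "('a::real_normed_vector \<Rightarrow> real) \<Rightarrow> 'a \<Rightarrow> 'a \<Rightarrow> real" where
  "clarke_deriv j u v =
     real_of_ereal (Limsup (nhds u \<times>\<^sub>F at_right (0::real))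
       (\<lambda>(x, l). ereal ((j (x + l *\<^sub>R v) - j x) / l)))"

lemma ereal_clarke_deriv:
  fixes j :: "'a::real_normed_vector \<Rightarrow> real"
  assumes "locally_lipschitz j"
  shows "ereal (clarke_deriv j u v) =
    Limsup (nhds u \<times>\<^sub>F at_right (0::real)) (\<lambda>(x, l). ereal ((j (x + l *\<^sub>R v) - j x) / l))"
proof -
  let ?F = "nhds u \<times>\<^sub>F at_right (0::real)"
  let ?q = "\<lambda>(x, l). ereal ((j (x + l *\<^sub>R v) - j x) / l)"
  obtain U L where U: "open U" "u \<in> U" and L: "L-lipschitz_on U j"
    using assms unfolding locally_lipschitz_def by blast
  have fst: "filterlim fst (nhds u) ?F" by (rule filterlim_fst)
  have snd: "filterlim snd (at_right 0) ?F" by (rule filterlim_snd)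
  have snd0: "(snd \<longlongrightarrow> 0) ?F"
    using snd by (simp add: filterlim_at)
  have "((\<lambda>p. fst p + snd p *\<^sub>R v) \<longlongrightarrow> u + 0 *\<^sub>R v) ?F"
    by (intro tendsto_intros fst snd0)
  then have e1: "\<forall>\<^sub>F p in ?F. fst p + snd p *\<^sub>R v \<in> U"
    using U by (auto intro: topological_tendstoD)
  have e2: "\<forall>\<^sub>F p in ?F. fst p \<in> U"
    using fst U by (auto intro: topological_tendstoD)
  have e3: "\<forall>\<^sub>F p in ?F. snd p > 0"
    using snd by (auto simp: filterlim_at elim: eventually_mono)
  have ev: "\<forall>\<^sub>F p in ?F. \<bar>(j (fst p + snd p *\<^sub>R v) - j (fst p)) / snd p\<bar> \<le> L * norm v"
    using e1 e2 e3
  proof eventually_elim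
    case (elim p)
    then have "dist (j (fst p + snd p *\<^sub>R v)) (j (fst p)) \<le> L * dist (fst p + snd p *\<^sub>R v) (fst p)"
      using lipschitz_onD[OF L] by blast
    with elim show ?case
      by (simp add: dist_norm field_simps)
  qed
  have nb: "?F \<noteq> bot"
    by (simp add: prod_filter_eq_bot trivial_limit_at_right_real)
  have up: "Limsup ?F ?q \<le> ereal (L * norm v)"
    by (rule Limsup_bounded, rule eventually_mono[OF ev]) (auto simp: abs_le_iff simp del: abs_divide)
  have "ereal (- (L * norm v)) \<le> Liminf ?F ?q"
    by (rule Liminf_bounded, rule eventually_mono[OF ev])
       (auto simp: abs_le_iff simp del: abs_divide uminus_ereal.simps)
  then have lo: "ereal (- (L * norm v)) \<le> Limsup ?F ?q"
    using Liminf_le_Limsup[OF nb, of ?q] by order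
  have "\<bar>Limsup ?F ?q\<bar> \<noteq> \<infinity>"
    using up lo by auto
  then show ?thesis
    unfolding clarke_deriv_def by (simp add: ereal_real')
qed

text \<open>The dual space is \<open>'a \<Rightarrow>\<^sub>L real\<close>; the duality pairing is application \<open>blinfun_apply\<close>.\<close>

definition vhi_solution ::
  "'a::real_normed_vector set \<Rightarrow> ('a \<Rightarrow> 'a \<Rightarrow>\<^sub>L real) \<Rightarrow> ('a \<Rightarrow> 'a \<Rightarrow> real) \<Rightarrow> ('a \<Rightarrow> real)
    \<Rightarrow> ('a \<Rightarrow>\<^sub>L real) \<Rightarrow> 'a \<Rightarrow> bool" where
  "vhi_solution K A \<phi> j f u \<longleftrightarrow> u \<in> K \<and>
     (\<forall>v\<in>K. blinfun_apply (A u) (v - u) + \<phi> u v - \<phi> u u + clarke_deriv j u (v - u)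
        \<ge> blinfun_apply f (v - u))"

definition vhi_approximating ::
  "'a::real_normed_vector set \<Rightarrow> ('a \<Rightarrow> 'a \<Rightarrow>\<^sub>L real) \<Rightarrow> ('a \<Rightarrow> 'a \<Rightarrow> real) \<Rightarrow> ('a \<Rightarrow> real)
    \<Rightarrow> ('a \<Rightarrow>\<^sub>L real) \<Rightarrow> (nat \<Rightarrow> 'a) \<Rightarrow> bool" where
  "vhi_approximating K A \<phi> j f un \<longleftrightarrow> (\<forall>n. un n \<in> K) \<and>
     (\<exists>\<epsilon>::nat \<Rightarrow> real. (\<forall>n. 0 < \<epsilon> n) \<and> \<epsilon> \<longlonglongrightarrow> 0 \<and>
        (\<forall>n. \<forall>v\<in>K. blinfun_apply (A (un n)) (v - un n) + \<phi> (un n) v - \<phi> (un n) (un n)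
             + clarke_deriv j (un n) (v - un n)
           \<ge> blinfun_apply f (v - un n) - \<epsilon> n * norm (un n - v)))"

definition vhi_well_posed ::
  "'a::real_normed_vector set \<Rightarrow> ('a \<Rightarrow> 'a \<Rightarrow>\<^sub>L real) \<Rightarrow> ('a \<Rightarrow> 'a \<Rightarrow> real) \<Rightarrow> ('a \<Rightarrow> real)
    \<Rightarrow> ('a \<Rightarrow>\<^sub>L real) \<Rightarrow> bool" where
  "vhi_well_posed K A \<phi> j f \<longleftrightarrow>
     (\<exists>!u. vhi_solution K A \<phi> j f u) \<and>
     (\<forall>u un. vhi_solution K A \<phi> j f u \<longrightarrow> vhi_approximating K A \<phi> j f un \<longrightarrow> un \<longlonglongrightarrow> u)"

end

theory Submission
  imports Defs
begin

text \<open>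
  Well-posedness contains unique solvability, so everything rests on the convergence of
  approximating sequences. Let \<open>u\<close> solve the inequality and let \<open>w\<close> solve it up to an error
  \<open>e * norm (w - v)\<close>. Test the inequality for \<open>u\<close> with \<open>w\<close> and the one for \<open>w\<close> with \<open>u\<close>. On
  addition \<open>f\<close> cancels; the operator contributes at most \<open>- m * (norm (w - u))\<^sup>2\<close>, while \<open>\<phi>\<close> and
  the Clarke derivative contribute at most \<open>(a + b) * (norm (w - u))\<^sup>2\<close>. Since \<open>a + b < m\<close>, the
  monotonicity wins, which leaves \<open>norm (w - u) \<le> e / (m - a - b)\<close>. The errors of an
  approximating sequence tend to zero, so the sequence tends to \<open>u\<close>. The estimate,
  \<open>vhi_approximate_solution_error\<close>, also gives a rate of convergence.
\<close>

text \<open>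
  The error allowed at \<open>w\<close> is proportional to the distance from \<open>w\<close>, so a factor
  \<open>norm (w - u)\<close> can be cancelled; this makes the bound linear in \<open>e\<close>.
\<close>

lemma vhi_approximate_solution_error:
  fixes A :: "'a::real_normed_vector \<Rightarrow> 'a \<Rightarrow>\<^sub>L real"
  assumes sol: "vhi_solution K A \<phi> j f u"
    and w: "w \<in> K"
    and approx: "\<And>v. v \<in> K \<Longrightarrow>
      blinfun_apply (A w) (v - w) + \<phi> w v - \<phi> w w + clarke_deriv j w (v - w)
        \<ge> blinfun_apply f (v - w) - e * norm (w - v)"
    and mono: "blinfun_apply (A w - A u) (w - u) \<ge> m * (norm (w - u))\<^sup>2"
    and phi: "\<phi> u w - \<phi> u u + \<phi> w u - \<phi> w w \<le> a * (norm (w - u))\<^sup>2"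
    and clarke: "clarke_deriv j u (w - u) + clarke_deriv j w (u - w) \<le> b * (norm (w - u))\<^sup>2"
    and small: "a + b < m"
    and "0 \<le> e"
  shows "norm (w - u) \<le> e / (m - a - b)"
proof -
  have u: "u \<in> K"
    and at_u: "blinfun_apply (A u) (w - u) + \<phi> u w - \<phi> u u + clarke_deriv j u (w - u)
      \<ge> blinfun_apply f (w - u)"
    using sol w unfolding vhi_solution_def by auto
  have reverse: "blinfun_apply T (u - w) = - blinfun_apply T (w - u)" for T :: "'a \<Rightarrow>\<^sub>L real"
    by (metis blinfun.minus_right minus_diff_eq)
  have at_w: "- blinfun_apply (A w) (w - u) + \<phi> w u - \<phi> w w + clarke_deriv j w (u - w)
      \<ge> - blinfun_apply f (w - u) - e * norm (w - u)"
    using approx[OF u] by (simp add: reverse)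
  have "m * (norm (w - u))\<^sup>2
      \<le> a * (norm (w - u))\<^sup>2 + b * (norm (w - u))\<^sup>2 + e * norm (w - u)"
    using at_u at_w mono phi clarke by (simp add: blinfun.diff_left)
  then have "((m - a - b) * norm (w - u)) * norm (w - u) \<le> e * norm (w - u)"
    by (simp add: power2_eq_square algebra_simps)
  then have "norm (w - u) = 0 \<or> (m - a - b) * norm (w - u) \<le> e"
    by (metis less_eq_real_def mult_le_cancel_right norm_ge_zero not_le)
  then show ?thesis
    using small \<open>0 \<le> e\<close> by (auto simp: field_simps)
qed

theorem theorem14:
  fixes K :: "'a::banach set"
    and A :: "'a \<Rightarrow> 'a \<Rightarrow>\<^sub>L real"
    and \<phi> :: "'a \<Rightarrow> 'a \<Rightarrow> real"
    and j :: "'a \<Rightarrow> real"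
    and m\<^sub>A \<alpha>\<^sub>\<phi> \<alpha>\<^sub>j :: real
  assumes "K \<noteq> {}"
    and "locally_lipschitz j"
    and "m\<^sub>A > 0"
    and "\<And>v1 v2. blinfun_apply (A v1 - A v2) (v1 - v2) \<ge> m\<^sub>A * (norm (v1 - v2))\<^sup>2"
    and "\<alpha>\<^sub>\<phi> > 0"
    and "\<And>\<eta>1 \<eta>2 v1 v2. \<phi> \<eta>1 v2 - \<phi> \<eta>1 v1 + \<phi> \<eta>2 v1 - \<phi> \<eta>2 v2
           \<le> \<alpha>\<^sub>\<phi> * norm (\<eta>1 - \<eta>2) * norm (v1 - v2)"
    and "\<alpha>\<^sub>j > 0"
    and "\<And>v1 v2. clarke_deriv j v1 (v2 - v1) + clarke_deriv j v2 (v1 - v2)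
           \<le> \<alpha>\<^sub>j * (norm (v1 - v2))\<^sup>2"
    and "\<alpha>\<^sub>\<phi> + \<alpha>\<^sub>j < m\<^sub>A"
  shows "\<forall>f :: 'a \<Rightarrow>\<^sub>L real.
           (\<exists>!u. vhi_solution K A \<phi> j f u) \<longleftrightarrow> vhi_well_posed K A \<phi> j f"
proof (intro allI iffI)
  fix f :: "'a \<Rightarrow>\<^sub>L real"
  assume unique: "\<exists>!u. vhi_solution K A \<phi> j f u"
  have "un \<longlonglongrightarrow> u"
    if sol: "vhi_solution K A \<phi> j f u" and approximating: "vhi_approximating K A \<phi> j f un"
    for u un
  proof -
    obtain \<epsilon> where pos: "\<And>n. 0 < \<epsilon> n" and to_0: "\<epsilon> \<longlonglongrightarrow> 0"
      and approx: "\<And>n v. v \<in> K \<Longrightarrow>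
        blinfun_apply (A (un n)) (v - un n) + \<phi> (un n) v - \<phi> (un n) (un n)
          + clarke_deriv j (un n) (v - un n)
          \<ge> blinfun_apply f (v - un n) - \<epsilon> n * norm (un n - v)"
      using approximating unfolding vhi_approximating_def by blast
    have "norm (un n - u) \<le> \<epsilon> n / (m\<^sub>A - \<alpha>\<^sub>\<phi> - \<alpha>\<^sub>j)" for n
    proof (rule vhi_approximate_solution_error[OF sol _ approx])
      show "un n \<in> K"
        using approximating unfolding vhi_approximating_def by blast
      show "\<phi> u (un n) - \<phi> u u + \<phi> (un n) u - \<phi> (un n) (un n) \<le> \<alpha>\<^sub>\<phi> * (norm (un n - u))\<^sup>2"
        using assms(6)[of u "un n" u "un n"]
        by (simp add: power2_eq_square norm_minus_commute mult.assoc)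
      show "clarke_deriv j u (un n - u) + clarke_deriv j (un n) (u - un n)
          \<le> \<alpha>\<^sub>j * (norm (un n - u))\<^sup>2"
        using assms(8)[of u "un n"] by (simp add: norm_minus_commute)
    qed (use assms(4,9) pos[of n] in auto)
    moreover have "(\<lambda>n. \<epsilon> n / (m\<^sub>A - \<alpha>\<^sub>\<phi> - \<alpha>\<^sub>j)) \<longlonglongrightarrow> 0"
      using to_0 by (rule tendsto_divide_zero)
    ultimately have "(\<lambda>n. un n - u) \<longlonglongrightarrow> 0"
      by (intro Lim_null_comparison[of "\<lambda>n. un n - u"] always_eventually allI)
    then show ?thesis
      by (simp add: LIM_zero_iff)
  qed
  with unique show "vhi_well_posed K A \<phi> j f"
    unfolding vhi_well_posed_def by blast
qed (simp add: vhi_well_posed_def)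

end
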